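(* Let $G=(V,E)$ be an undirected graph, let $\ell$ be a leader for the symmetry group $\Gamma$ of the stable set problem over $G$, with orbit $O_\ell$. Then for each clique $C\subseteq O_\ell$ the SST clique cut $$-x_\ell+\sum_{f\in C}x_f\le 0$$ is a symmetry handling inequality. Explicitly: for every incidence vector $x\in\{0,1\}^V$ of a stable set of $G$ there exists $\gamma\in\Gamma$ such that $\gamma(x)$ satisfies all SST cuts and all these SST clique cuts.
   Context: All graphs are finite, simple and undirected. A clique is a set of pairwise adjacent nodes. $\Gamma\le\mathcal{S}_V$ is a group of automorphisms of $G$ preserving the node weights; it acts on vectors by $\gamma(x)_v=x_{\gamma^{-1}(v)}$. Symmetry handling inequalities (SHIs) are inequalities such that for every feasible solution $x$ there is a symmetric solution $\gamma(x)$, $\gamma\in\Gamma$, satisfying all SHIs. SST algorithm: initialize $\Gamma'\gets\Gamma$ and the empty sequence $L$. Repeat until $L$ contains all of $V$: (1) select (arbitrarily) $\ell\in V\setminus L$ and set $O_\ell\gets\{\gamma(\ell):\gamma\in\Gamma'\}$; (2) append $\ell$ to $L$ and replace $\Gamma'$ by its subgroup of permutations fixing every element of $L$. The elements of $L$ are the leaders, $O_\ell$ is the orbit of leader $\ell$, and the SST cuts are the inequalities $-x_\ell+x_f\le 0$ for $\ell\in L$, $f\in O_\ell\setminus\{\ell\}$. *)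

theory Defs
  imports Complex_Main "HOL-Combinatorics.Permutations" "HOL-Algebra.Group"
    "HOL-Library.Indicator_Function"
begin

definition simple_graph :: "'a set \<Rightarrow> 'a set set \<Rightarrow> bool" where
  "simple_graph V E \<longleftrightarrow> finite V \<and> (\<forall>e\<in>E. e \<subseteq> V \<and> card e = 2)"

definition clique :: "'a set \<Rightarrow> 'a set set \<Rightarrow> 'a set \<Rightarrow> bool" where
  "clique V E C \<longleftrightarrow> C \<subseteq> V \<and> (\<forall>u\<in>C. \<forall>v\<in>C. u \<noteq> v \<longrightarrow> {u, v} \<in> E)"

definition stable_set :: "'a set \<Rightarrow> 'a set set \<Rightarrow> 'a set \<Rightarrow> bool" where
  "stable_set V E S \<longleftrightarrow> S \<subseteq> V \<and> (\<forall>u\<in>S. \<forall>v\<in>S. {u, v} \<notin> E)"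

text \<open>A vector indexed by \<open>V\<close> is a function on the whole type; incidence vectors vanish
  outside \<open>V\<close>.\<close>

definition stable_set_vectors :: "'a set \<Rightarrow> 'a set set \<Rightarrow> ('a \<Rightarrow> real) set" where
  "stable_set_vectors V E = {indicator S | S. stable_set V E S}"

text \<open>The symmetric group of an arbitrary set \<open>V\<close>; the library's \<open>sym_group\<close> covers only
  \<open>{1..n}\<close>. Permutations of \<open>V\<close> are the identity outside \<open>V\<close>.\<close>

definition sym_group_on :: "'a set \<Rightarrow> ('a \<Rightarrow> 'a) monoid" where
  "sym_group_on V = \<lparr>carrier = {p. p permutes V}, mult = (\<circ>), one = id\<rparr>"

lemma group_sym_group_on: "group (sym_group_on V)"
proof (rule groupI)
  fix p assume "p \<in> carrier (sym_group_on V)"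
  then have "p permutes V" by (simp add: sym_group_on_def)
  then have "inv_into UNIV p permutes V" "inv_into UNIV p \<circ> p = id"
    by (auto simp: permutes_inv permutes_inv_o)
  then show "\<exists>q\<in>carrier (sym_group_on V). q \<otimes>\<^bsub>sym_group_on V\<^esub> p = \<one>\<^bsub>sym_group_on V\<^esub>"
    by (auto simp: sym_group_on_def)
qed (auto simp: sym_group_on_def permutes_compose permutes_id comp_assoc)

definition graph_automorphism :: "'a set \<Rightarrow> 'a set set \<Rightarrow> ('a \<Rightarrow> 'a) \<Rightarrow> bool" where
  "graph_automorphism V E \<gamma> \<longleftrightarrow>
     \<gamma> permutes V \<and> (\<forall>u\<in>V. \<forall>v\<in>V. {\<gamma> u, \<gamma> v} \<in> E \<longleftrightarrow> {u, v} \<in> E)"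

definition stable_set_symmetry_group ::
  "'a set \<Rightarrow> 'a set set \<Rightarrow> ('a \<Rightarrow> real) \<Rightarrow> ('a \<Rightarrow> 'a) set \<Rightarrow> bool" where
  "stable_set_symmetry_group V E w \<Gamma> \<longleftrightarrow>
     subgroup \<Gamma> (sym_group_on V) \<and>
     (\<forall>\<gamma>\<in>\<Gamma>. graph_automorphism V E \<gamma> \<and> (\<forall>v\<in>V. w (\<gamma> v) = w v))"

definition act :: "('a \<Rightarrow> 'a) \<Rightarrow> ('a \<Rightarrow> real) \<Rightarrow> 'a \<Rightarrow> real" where
  "act \<gamma> x = (\<lambda>v. x (inv_into UNIV \<gamma> v))"

text \<open>Inequalities are represented as predicates on vectors. Being symmetry handling is a joint
  property of a family \<open>I\<close> of inequalities: a single \<open>\<gamma>\<close>, depending on the feasible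
  solution only, has to serve all members of \<open>I\<close>.\<close>

definition symmetry_handling ::
  "('a \<Rightarrow> 'a) set \<Rightarrow> ('a \<Rightarrow> real) set \<Rightarrow> (('a \<Rightarrow> real) \<Rightarrow> bool) set \<Rightarrow> bool" where
  "symmetry_handling \<Gamma> X I \<longleftrightarrow>
     (\<forall>x\<in>X. \<exists>\<gamma>\<in>\<Gamma>. act \<gamma> x \<in> X \<and> (\<forall>P\<in>I. P (act \<gamma> x)))"

text \<open>\<open>sst_state V \<Gamma> \<Gamma>' L Orb\<close>: after some iterations of the SST algorithm started with
  \<open>\<Gamma>\<close>, the current group is \<open>\<Gamma>'\<close>, the leaders chosen so far are \<open>L\<close> in order of selection,
  and \<open>Orb l\<close> is the orbit recorded for leader \<open>l\<close> (a dummy value for other nodes).\<close>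

inductive sst_state ::
  "'a set \<Rightarrow> ('a \<Rightarrow> 'a) set \<Rightarrow> ('a \<Rightarrow> 'a) set \<Rightarrow> 'a list \<Rightarrow> ('a \<Rightarrow> 'a set) \<Rightarrow> bool"
  for V :: "'a set" and \<Gamma> :: "('a \<Rightarrow> 'a) set" where
  init: "sst_state V \<Gamma> \<Gamma> [] (\<lambda>_. {})"
| step: "sst_state V \<Gamma> \<Gamma>' L Orb \<Longrightarrow> l \<in> V - set L \<Longrightarrow>
    sst_state V \<Gamma> {\<gamma> \<in> \<Gamma>'. \<forall>v\<in>set (L @ [l]). \<gamma> v = v} (L @ [l])
      (Orb(l := {\<gamma> l | \<gamma>. \<gamma> \<in> \<Gamma>'}))"

definition sst_result ::
  "'a set \<Rightarrow> ('a \<Rightarrow> 'a) set \<Rightarrow> 'a list \<Rightarrow> ('a \<Rightarrow> 'a set) \<Rightarrow> bool" where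
  "sst_result V \<Gamma> L Orb \<longleftrightarrow> (\<exists>\<Gamma>'. sst_state V \<Gamma> \<Gamma>' L Orb) \<and> set L = V"

definition sst_cut :: "'a \<Rightarrow> 'a \<Rightarrow> ('a \<Rightarrow> real) \<Rightarrow> bool" where
  "sst_cut l f x \<longleftrightarrow> - x l + x f \<le> 0"

definition sst_clique_cut :: "'a \<Rightarrow> 'a set \<Rightarrow> ('a \<Rightarrow> real) \<Rightarrow> bool" where
  "sst_clique_cut l C x \<longleftrightarrow> - x l + (\<Sum>f\<in>C. x f) \<le> 0"

definition sst_cuts :: "'a list \<Rightarrow> ('a \<Rightarrow> 'a set) \<Rightarrow> (('a \<Rightarrow> real) \<Rightarrow> bool) set" where
  "sst_cuts L Orb = {sst_cut l f | l f. l \<in> set L \<and> f \<in> Orb l - {l}}"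

definition sst_clique_cuts ::
  "'a set \<Rightarrow> 'a set set \<Rightarrow> 'a list \<Rightarrow> ('a \<Rightarrow> 'a set) \<Rightarrow> (('a \<Rightarrow> real) \<Rightarrow> bool) set" where
  "sst_clique_cuts V E L Orb =
     {sst_clique_cut l C | l C. l \<in> set L \<and> C \<subseteq> Orb l \<and> clique V E C}"

end

theory Submission
  imports Defs
begin

text \<open>The SST cuts say that every leader attains the maximum of the vector over its orbit. Any
  vector can be moved to one with this property by treating the leaders in order of selection:
  when the leader \<open>l\<close> with current group \<open>\<Gamma>'\<close> is reached, pick \<open>\<delta> \<in> \<Gamma>'\<close> such that
  \<open>\<delta> l\<close> is a maximiser on the orbit of \<open>l\<close>, and apply the inverse of \<open>\<delta>\<close>. This does not
  destroy what was achieved before, because \<open>\<delta>\<close> fixes each earlier leader and maps its orbit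
  into itself (\<open>sst_state_invariant\<close>); hence one \<open>\<gamma> \<in> \<Gamma>\<close> serves all SST cuts
  (\<open>sst_state_leaders_maximal\<close>). For an incidence vector of a stable set the clique cuts
  then come for free: a clique contains at most one node of the stable set, so the sum over
  the clique is either zero or the single value \<open>x f = 1\<close>, which is at most \<open>x l\<close> by the
  SST cut for \<open>f\<close>, or trivially if \<open>f = l\<close> (\<open>stable_set_imp_sst_clique_cut\<close>).\<close>

lemma inv_sym_group_on:
  assumes "\<gamma> permutes V"
  shows "inv\<^bsub>sym_group_on V\<^esub> \<gamma> = inv_into UNIV \<gamma>"
  using assms by (intro group.inv_equality[OF group_sym_group_on])
    (auto simp: sym_group_on_def permutes_inv permutes_inv_o)

lemma subgroup_sym_group_onD:
  assumes "subgroup \<Gamma> (sym_group_on V)"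
  shows "\<gamma> \<in> \<Gamma> \<Longrightarrow> \<gamma> permutes V"
    and "id \<in> \<Gamma>"
    and "\<gamma> \<in> \<Gamma> \<Longrightarrow> \<delta> \<in> \<Gamma> \<Longrightarrow> \<gamma> \<circ> \<delta> \<in> \<Gamma>"
    and "\<gamma> \<in> \<Gamma> \<Longrightarrow> inv_into UNIV \<gamma> \<in> \<Gamma>"
proof -
  show perm: "\<gamma> permutes V" if "\<gamma> \<in> \<Gamma>" for \<gamma>
    using subgroup.mem_carrier[OF assms that] by (simp add: sym_group_on_def)
  show "id \<in> \<Gamma>"
    using subgroup.one_closed[OF assms] by (simp add: sym_group_on_def)
  show "\<gamma> \<circ> \<delta> \<in> \<Gamma>" if "\<gamma> \<in> \<Gamma>" "\<delta> \<in> \<Gamma>"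
    using subgroup.m_closed[OF assms that] by (simp add: sym_group_on_def)
  assume mem: "\<gamma> \<in> \<Gamma>"
  show "inv_into UNIV \<gamma> \<in> \<Gamma>"
    using subgroup.m_inv_closed[OF assms mem] inv_sym_group_on[OF perm[OF mem]] by simp
qed

lemma subgroup_pointwise_stabilizer:
  assumes \<Gamma>: "subgroup \<Gamma> (sym_group_on V)"
  shows "subgroup {\<gamma> \<in> \<Gamma>. \<forall>v\<in>A. \<gamma> v = v} (sym_group_on V)"
proof (rule group.subgroupI[OF group_sym_group_on])
  note D = subgroup_sym_group_onD[OF \<Gamma>]
  show "{\<gamma> \<in> \<Gamma>. \<forall>v\<in>A. \<gamma> v = v} \<subseteq> carrier (sym_group_on V)"
    using D(1) by (auto simp: sym_group_on_def)
  show "{\<gamma> \<in> \<Gamma>. \<forall>v\<in>A. \<gamma> v = v} \<noteq> {}"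
    using D(2) by (auto intro!: exI[of _ id])
  show "\<gamma> \<otimes>\<^bsub>sym_group_on V\<^esub> \<delta> \<in> {\<gamma> \<in> \<Gamma>. \<forall>v\<in>A. \<gamma> v = v}"
    if "\<gamma> \<in> {\<gamma> \<in> \<Gamma>. \<forall>v\<in>A. \<gamma> v = v}" "\<delta> \<in> {\<gamma> \<in> \<Gamma>. \<forall>v\<in>A. \<gamma> v = v}" for \<gamma> \<delta>
    using that D(3) by (auto simp: sym_group_on_def)
  fix \<gamma> assume mem: "\<gamma> \<in> {\<gamma> \<in> \<Gamma>. \<forall>v\<in>A. \<gamma> v = v}"
  have perm: "\<gamma> permutes V" using mem D(1) by auto
  have "inv_into UNIV \<gamma> v = v" if "v \<in> A" for v
    using permutes_inverses(2)[OF perm, of v] mem that by auto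
  then show "inv\<^bsub>sym_group_on V\<^esub> \<gamma> \<in> {\<gamma> \<in> \<Gamma>. \<forall>v\<in>A. \<gamma> v = v}"
    using mem D(4) inv_sym_group_on[OF perm] by auto
qed

lemma sst_state_invariant:
  assumes "sst_state V \<Gamma> \<Gamma>' L Orb" and "subgroup \<Gamma> (sym_group_on V)"
  shows "subgroup \<Gamma>' (sym_group_on V)" and "\<Gamma>' \<subseteq> \<Gamma>"
    and "\<And>\<gamma> l. \<gamma> \<in> \<Gamma>' \<Longrightarrow> l \<in> set L \<Longrightarrow> \<gamma> l = l"
    and "\<And>\<gamma> l. \<gamma> \<in> \<Gamma>' \<Longrightarrow> l \<in> set L \<Longrightarrow> \<gamma> ` Orb l \<subseteq> Orb l"
proof -
  have "subgroup \<Gamma>' (sym_group_on V) \<and> \<Gamma>' \<subseteq> \<Gamma> \<and>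
    (\<forall>\<gamma>\<in>\<Gamma>'. \<forall>l\<in>set L. \<gamma> l = l \<and> \<gamma> ` Orb l \<subseteq> Orb l)"
    using assms(1)
  proof (induction rule: sst_state.induct)
    case init
    then show ?case using assms(2) by simp
  next
    case (step \<Gamma>' L Orb l)
    have sub: "subgroup \<Gamma>' (sym_group_on V)" using step.IH by simp
    have orb: "\<gamma> ` {\<delta> l | \<delta>. \<delta> \<in> \<Gamma>'} \<subseteq> {\<delta> l | \<delta>. \<delta> \<in> \<Gamma>'}" if "\<gamma> \<in> \<Gamma>'" for \<gamma>
    proof
      fix u assume "u \<in> \<gamma> ` {\<delta> l | \<delta>. \<delta> \<in> \<Gamma>'}"
      then obtain \<delta> where "\<delta> \<in> \<Gamma>'" "u = (\<gamma> \<circ> \<delta>) l" by auto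
      then show "u \<in> {\<delta> l | \<delta>. \<delta> \<in> \<Gamma>'}"
        using subgroup_sym_group_onD(3)[OF sub that] by blast
    qed
    show ?case
    proof (intro conjI ballI)
      show "subgroup {\<gamma> \<in> \<Gamma>'. \<forall>v\<in>set (L @ [l]). \<gamma> v = v} (sym_group_on V)"
        by (rule subgroup_pointwise_stabilizer[OF sub])
      show "{\<gamma> \<in> \<Gamma>'. \<forall>v\<in>set (L @ [l]). \<gamma> v = v} \<subseteq> \<Gamma>" using step.IH by auto
      fix \<gamma> k
      assume \<gamma>: "\<gamma> \<in> {\<gamma> \<in> \<Gamma>'. \<forall>v\<in>set (L @ [l]). \<gamma> v = v}" and k: "k \<in> set (L @ [l])"
      show "\<gamma> k = k" using \<gamma> k by blast
      show "\<gamma> ` (Orb(l := {\<gamma> l | \<gamma>. \<gamma> \<in> \<Gamma>'})) k \<subseteq> (Orb(l := {\<gamma> l | \<gamma>. \<gamma> \<in> \<Gamma>'})) k"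
      proof (cases "k = l")
        case True
        then show ?thesis using orb[of \<gamma>] \<gamma> by simp
      next
        case False
        then have "k \<in> set L" using k by simp
        then show ?thesis using step.IH \<gamma> False by simp
      qed
    qed
  qed
  then show "subgroup \<Gamma>' (sym_group_on V)" and "\<Gamma>' \<subseteq> \<Gamma>"
    and "\<And>\<gamma> l. \<gamma> \<in> \<Gamma>' \<Longrightarrow> l \<in> set L \<Longrightarrow> \<gamma> l = l"
    and "\<And>\<gamma> l. \<gamma> \<in> \<Gamma>' \<Longrightarrow> l \<in> set L \<Longrightarrow> \<gamma> ` Orb l \<subseteq> Orb l"
    by blast+
qed

lemma act_comp:
  assumes "bij \<gamma>" and "bij \<delta>"
  shows "act (\<gamma> \<circ> \<delta>) x = act \<gamma> (act \<delta> x)"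
  using assms by (simp add: act_def o_inv_distrib)

text \<open>Integrality of \<open>x\<close> is not needed: the orbits are finite, so every real vector attains
  its maximum on each of them.\<close>

lemma sst_state_leaders_maximal:
  fixes x :: "'a \<Rightarrow> real"
  assumes "sst_state V \<Gamma> \<Gamma>' L Orb" and \<Gamma>: "subgroup \<Gamma> (sym_group_on V)" and "finite V"
  shows "\<exists>\<gamma>\<in>\<Gamma>. \<forall>l\<in>set L. \<forall>f\<in>Orb l. act \<gamma> x f \<le> act \<gamma> x l"
  using assms(1)
proof (induction rule: sst_state.induct)
  case init
  then show ?case using subgroup_sym_group_onD(2)[OF \<Gamma>] by auto
next
  case (step \<Gamma>' L Orb l)
  note inv = sst_state_invariant[OF step.hyps(1) \<Gamma>]
  note D = subgroup_sym_group_onD[OF inv(1)]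
  obtain \<gamma> where \<gamma>: "\<gamma> \<in> \<Gamma>" "\<And>k f. k \<in> set L \<Longrightarrow> f \<in> Orb k \<Longrightarrow> act \<gamma> x f \<le> act \<gamma> x k"
    using step.IH by blast
  let ?O = "{\<delta> l | \<delta>. \<delta> \<in> \<Gamma>'}"
  let ?M = "Max (act \<gamma> x ` ?O)"
  have "?O \<subseteq> V"
  proof
    fix u assume "u \<in> ?O"
    then obtain \<delta> where "\<delta> permutes V" "u = \<delta> l" using D(1) by blast
    then show "u \<in> V" using step.hyps(2) by (simp add: permutes_in_image)
  qed
  then have fin: "finite (act \<gamma> x ` ?O)" using \<open>finite V\<close> finite_subset by blast
  have "act \<gamma> x ` ?O \<noteq> {}" using D(2) by blast
  from Max_in[OF fin this] obtain \<delta> where \<delta>: "\<delta> \<in> \<Gamma>'" "?M = act \<gamma> x (\<delta> l)" by auto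
  have max: "act \<gamma> x u \<le> act \<gamma> x (\<delta> l)" if "u \<in> ?O" for u
    using Max_ge[OF fin, of "act \<gamma> x u"] \<delta>(2) that by auto
  let ?\<gamma> = "inv_into UNIV \<delta> \<circ> \<gamma>"
  have bij: "bij \<gamma>" "bij \<delta>"
    using subgroup_sym_group_onD(1)[OF \<Gamma> \<gamma>(1)] D(1)[OF \<delta>(1)] by (auto intro: permutes_bij)
  have act: "act ?\<gamma> x v = act \<gamma> x (\<delta> v)" for v
  proof -
    have "act ?\<gamma> x = act (inv_into UNIV \<delta>) (act \<gamma> x)"
      by (rule act_comp[OF bij_imp_bij_inv[OF bij(2)] bij(1)])
    then show ?thesis by (simp add: act_def inv_inv_eq[OF bij(2)])
  qed
  have "?\<gamma> \<in> \<Gamma>"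
    using subgroup_sym_group_onD(3)[OF \<Gamma>] D(4)[OF \<delta>(1)] inv(2) \<gamma>(1) by blast
  moreover have "act ?\<gamma> x f \<le> act ?\<gamma> x k"
    if k: "k \<in> set (L @ [l])" and f: "f \<in> (Orb(l := ?O)) k" for k f
  proof (cases "k = l")
    case True
    then obtain \<epsilon> where \<epsilon>: "\<epsilon> \<in> \<Gamma>'" "f = \<epsilon> l" using f by auto
    have "(\<delta> \<circ> \<epsilon>) l \<in> ?O" using D(3)[OF \<delta>(1) \<epsilon>(1)] by blast
    then show ?thesis using max[of "\<delta> f"] \<epsilon>(2) True by (simp add: act)
  next
    case False
    \<comment> \<open>An earlier leader: \<open>\<delta>\<close> fixes \<open>k\<close> and keeps \<open>f\<close> in the orbit of \<open>k\<close>.\<close>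
    then have k: "k \<in> set L" and f: "f \<in> Orb k" using k f by auto
    have "\<delta> f \<in> Orb k" using inv(4)[OF \<delta>(1) k] f by blast
    then show ?thesis using \<gamma>(2)[OF k] inv(3)[OF \<delta>(1) k] by (simp add: act)
  qed
  ultimately show ?case by blast
qed

lemma act_indicator:
  assumes "bij \<gamma>"
  shows "act \<gamma> (indicator S) = indicator (\<gamma> ` S)"
proof
  fix v
  have "inv_into UNIV \<gamma> v \<in> S \<longleftrightarrow> v \<in> \<gamma> ` S"
    using assms by (metis bij_inv_eq_iff image_iff)
  then show "act \<gamma> (indicator S) v = indicator (\<gamma> ` S) v"
    by (simp add: act_def indicator_def)
qed

lemma stable_set_image:
  assumes "graph_automorphism V E \<gamma>" and "stable_set V E S"
  shows "stable_set V E (\<gamma> ` S)"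
  using assms unfolding graph_automorphism_def stable_set_def
  by (auto simp: permutes_in_image subset_iff)

lemma stable_set_imp_sst_clique_cut:
  assumes "finite V" and "clique V E C" and "stable_set V E S"
    and le: "\<And>f. f \<in> C \<Longrightarrow> indicator S f \<le> (indicator S l :: real)"
  shows "sst_clique_cut l C (indicator S)"
proof -
  have "finite C" using assms(1,2) finite_subset by (auto simp: clique_def)
  then have sum: "(\<Sum>f\<in>C. indicator S f :: real) = real (card (C \<inter> S))"
    by (simp add: indicator_def sum.If_cases Int_def)
  have "(\<Sum>f\<in>C. indicator S f) \<le> (indicator S l :: real)"
  proof (cases "C \<inter> S = {}")
    case True
    then show ?thesis using sum by simp
  next
    case False
    then obtain f where f: "f \<in> C" "f \<in> S" by blast
    have "u = f" if "u \<in> C \<inter> S" for u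
      using that f assms(2,3) unfolding clique_def stable_set_def by blast
    then have "C \<inter> S = {f}" using f by blast
    then show ?thesis using sum le[OF f(1)] f(2) by simp
  qed
  then show ?thesis by (simp add: sst_clique_cut_def)
qed

theorem corollary4p15:
  fixes V :: "'a set" and E :: "'a set set" and w :: "'a \<Rightarrow> real"
    and \<Gamma> :: "('a \<Rightarrow> 'a) set" and L :: "'a list" and Orb :: "'a \<Rightarrow> 'a set"
  assumes "simple_graph V E"
    and "stable_set_symmetry_group V E w \<Gamma>"
    and "sst_result V \<Gamma> L Orb"
  shows "symmetry_handling \<Gamma> (stable_set_vectors V E)
           (sst_cuts L Orb \<union> sst_clique_cuts V E L Orb)"
  unfolding symmetry_handling_def
proof
  fix x assume "x \<in> stable_set_vectors V E"
  then obtain S where S: "stable_set V E S" and x: "x = indicator S"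
    by (auto simp: stable_set_vectors_def)
  have fin: "finite V" using assms(1) by (simp add: simple_graph_def)
  have \<Gamma>: "subgroup \<Gamma> (sym_group_on V)" and aut: "\<And>\<gamma>. \<gamma> \<in> \<Gamma> \<Longrightarrow> graph_automorphism V E \<gamma>"
    using assms(2) by (auto simp: stable_set_symmetry_group_def)
  obtain \<Gamma>' where "sst_state V \<Gamma> \<Gamma>' L Orb"
    using assms(3) by (auto simp: sst_result_def)
  from sst_state_leaders_maximal[OF this \<Gamma> fin, of x]
  obtain \<gamma> where \<gamma>: "\<gamma> \<in> \<Gamma>"
    and max: "\<And>l f. l \<in> set L \<Longrightarrow> f \<in> Orb l \<Longrightarrow> act \<gamma> x f \<le> act \<gamma> x l"
    by blast
  have act: "act \<gamma> x = indicator (\<gamma> ` S)"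
    using act_indicator permutes_bij subgroup_sym_group_onD(1)[OF \<Gamma> \<gamma>] x by blast
  have stable: "stable_set V E (\<gamma> ` S)" by (rule stable_set_image[OF aut[OF \<gamma>] S])
  have "act \<gamma> x \<in> stable_set_vectors V E"
    using stable by (auto simp: act stable_set_vectors_def)
  moreover have "P (act \<gamma> x)" if "P \<in> sst_cuts L Orb" for P
    using that max by (auto simp: sst_cuts_def sst_cut_def)
  moreover have "P (act \<gamma> x)" if P: "P \<in> sst_clique_cuts V E L Orb" for P
  proof -
    obtain l C where C: "P = sst_clique_cut l C" "l \<in> set L" "C \<subseteq> Orb l" "clique V E C"
      using P by (auto simp: sst_clique_cuts_def)
    have "indicator (\<gamma> ` S) f \<le> (indicator (\<gamma> ` S) l :: real)" if "f \<in> C" for f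
      using max[of l f] that C(2,3) by (auto simp: act)
    then show ?thesis
      unfolding act C(1) by (rule stable_set_imp_sst_clique_cut[OF fin C(4) stable])
  qed
  ultimately show "\<exists>\<gamma>\<in>\<Gamma>. act \<gamma> x \<in> stable_set_vectors V E \<and>
      (\<forall>P\<in>sst_cuts L Orb \<union> sst_clique_cuts V E L Orb. P (act \<gamma> x))"
    using \<gamma> by blast
qed

end
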